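(* Let $T=(T_1,\ldots,T_k)$ be a $k$-tuple in the regular $\Lambda$-polyball $\mathbf B_\Lambda(\mathcal H)$ and let $V=(V_1,\ldots,V_k)$ be its minimal dilation on a Hilbert space $\mathcal K$. Then the following statements hold. (i) $V$ is a pure element in $\mathbf B_\Lambda(\mathcal K)$ if and only if $T$ is a pure element in $\mathbf B_\Lambda(\mathcal H)$. (ii) $\Delta_V(I_{\mathcal K})=0$ if and only if $\Delta_T(I_{\mathcal H})=0$.
   Context: Fix integers $k\ge1$, $n_1,\ldots,n_k\ge 1$ and, for $i\ne j$ in $\{1,\ldots,k\}$, an $n_i\times n_j$ matrix $\Lambda_{i,j}=[\lambda_{i,j}(s,t)]$ with entries in $\mathbb T=\{z\in\mathbb C:|z|=1\}$, such that $\lambda_{j,i}(t,s)=\overline{\lambda_{i,j}(s,t)}$. For $T=(T_1,\ldots,T_k)$ with $T_i=[T_{i,1}\cdots T_{i,n_i}]$, $T_{i,s}\in B(\mathcal H)$, let $\Phi_{rT_i}(X):=\sum_{s=1}^{n_i}r^2T_{i,s}XT_{i,s}^*$ and $\Delta_T(I):=(id-\Phi_{T_1})\circ\cdots\circ(id-\Phi_{T_k})(I)$. The regular $\Lambda$-polyball $\mathbf B_\Lambda(\mathcal H)$ is the set of $T$ with $\sum_sT_{i,s}T_{i,s}^*\le I$ for each $i$, $T_{i,s}T_{j,t}=\lambda_{i,j}(s,t)T_{j,t}T_{i,s}$ for all $i\ne j$, $s,t$, and $\Delta_{rT}(I)\ge0$ for all $r\in[0,1)$. $T$ is pure if $\Phi_{T_i}^m(I)\to0$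 strongly as $m\to\infty$ for each $i$. A $k$-tuple $V=(V_1,\ldots,V_k)$ of doubly $\Lambda$-commuting row isometries on $\mathcal K$ consists of rows $V_i=[V_{i,1}\cdots V_{i,n_i}]$ with $V_{i,s}^*V_{i,t}=\delta_{st}I$ and $V_{i,s}^*V_{j,t}=\overline{\lambda_{i,j}(s,t)}\,V_{j,t}V_{i,s}^*$ for all $i\neq j$ and all $s,t$. $\mathbb F_{n_i}^+$ is the unital free semigroup with $n_i$ generators $g^i_1,\ldots,g^i_{n_i}$ and neutral element $g^i_0$; $V_{i,\alpha}:=V_{i,p_1}\cdots V_{i,p_m}$ for $\alpha=g^i_{p_1}\cdots g^i_{p_m}$, $V_{i,g_0^i}:=I$. The minimal dilation of $T$ is the (unique up to isomorphism) $k$-tuple $V$ of doubly $\Lambda$-commuting row isometries on a Hilbert space $\mathcal K\supset\mathcal H$ with $T_{i,s}^*=V_{i,s}^*|_{\mathcal H}$ for all $i,s$ and $\mathcal K=\overline{\operatorname{span}}\{V_{1,\alpha_1}\cdots V_{k,\alpha_k}\mathcal H:\alpha_i\in\mathbb F_{n_i}^+\}$. It exists for every $T\in\mathbf B_\Lambda(\mathcal H)$. *)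

theory Defs
  imports "HOL-Analysis.Analysis" "HOL-Library.Nonpos_Ints"
begin

section \<open>Complex Hilbert spaces and their bounded operators\<close>

text \<open>The inner product is linear in its first argument. Positivity and definiteness are contained
  in \<open>cinner_self\<close>, which also says that the norm of the underlying (complete) normed space is the
  one induced by the inner product.\<close>

class complex_hilbert = banach +
  fixes scaleC :: "complex \<Rightarrow> 'a \<Rightarrow> 'a" (infixr "*\<^sub>C" 75)
    and cinner :: "'a \<Rightarrow> 'a \<Rightarrow> complex"
  assumes scaleC_add_right: "c *\<^sub>C (x + y) = c *\<^sub>C x + c *\<^sub>C y"
    and scaleC_add_left: "(c + d) *\<^sub>C x = c *\<^sub>C x + d *\<^sub>C x"
    and scaleC_scaleC: "c *\<^sub>C d *\<^sub>C x = (c * d) *\<^sub>C x"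
    and scaleC_of_real: "complex_of_real r *\<^sub>C x = r *\<^sub>R x"
    and cinner_commute: "cinner x y = cnj (cinner y x)"
    and cinner_add_left: "cinner (x + y) z = cinner x z + cinner y z"
    and cinner_scaleC_left: "cinner (c *\<^sub>C x) y = c * cinner x y"
    and cinner_self: "cinner x x = complex_of_real ((norm x)\<^sup>2)"

instantiation complex :: complex_hilbert
begin

definition scaleC_complex :: "complex \<Rightarrow> complex \<Rightarrow> complex" where
  "scaleC_complex c x = c * x"

definition cinner_complex :: "complex \<Rightarrow> complex \<Rightarrow> complex" where
  "cinner_complex x y = x * cnj y"

instance
  by standard (simp_all add: scaleC_complex_def cinner_complex_def algebra_simps
      scaleR_conv_of_real complex_norm_square del: of_real_power)

end

global_interpretation complex_vs: vector_space "scaleC :: complex \<Rightarrow> 'a \<Rightarrow> 'a::complex_hilbert"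
proof
  show "1 *\<^sub>C x = x" for x :: 'a
    using scaleC_of_real[of 1 x] by simp
qed (simp_all add: scaleC_add_right scaleC_add_left scaleC_scaleC)

definition bounded_clinear :: "('a::complex_hilbert \<Rightarrow> 'b::complex_hilbert) \<Rightarrow> bool" where
  "bounded_clinear A \<longleftrightarrow> bounded_linear A \<and> (\<forall>c x. A (c *\<^sub>C x) = c *\<^sub>C A x)"

definition isometric_embedding :: "('a::complex_hilbert \<Rightarrow> 'b::complex_hilbert) \<Rightarrow> bool" where
  "isometric_embedding J \<longleftrightarrow> bounded_clinear J \<and> (\<forall>x y. cinner (J x) (J y) = cinner x y)"

text \<open>Only meaningful for bounded complex linear \<open>A\<close>, where the described function exists and is
  unique by the Riesz representation theorem.\<close>

definition cadjoint :: "('a::complex_hilbert \<Rightarrow> 'a) \<Rightarrow> 'a \<Rightarrow> 'a" where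
  "cadjoint A = (THE B. \<forall>x y. cinner (A x) y = cinner x (B y))"

definition positive_op :: "('a::complex_hilbert \<Rightarrow> 'a) \<Rightarrow> bool" where
  "positive_op A \<longleftrightarrow> (\<forall>x. cinner (A x) x \<in> \<real>\<^sub>\<ge>\<^sub>0)"

definition op_le :: "('a::complex_hilbert \<Rightarrow> 'a) \<Rightarrow> ('a \<Rightarrow> 'a) \<Rightarrow> bool" where
  "op_le A B \<longleftrightarrow> positive_op (\<lambda>x. B x - A x)"

section \<open>Regular polyballs\<close>

text \<open>Indices run over \<open>i \<in> {1..k}\<close> and \<open>s \<in> {1..n i}\<close>; the operator \<open>T i s\<close> stands for \<open>T\<^sub>i\<^sub>,\<^sub>s\<close> and the
  number \<open>L i j s t\<close> for \<open>\<lambda>\<^sub>i\<^sub>,\<^sub>j(s,t)\<close>. Values outside these ranges are irrelevant.\<close>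

type_synonym 'a op_tuple = "nat \<Rightarrow> nat \<Rightarrow> 'a \<Rightarrow> 'a"

type_synonym phases = "nat \<Rightarrow> nat \<Rightarrow> nat \<Rightarrow> nat \<Rightarrow> complex"

text \<open>\<open>row_map r m S\<close> is \<open>\<Phi>\<^sub>r\<^sub>S\<close> for the row \<open>S = [S\<^sub>1 \<dots> S\<^sub>m]\<close>.\<close>

definition row_map ::
  "real \<Rightarrow> nat \<Rightarrow> (nat \<Rightarrow> 'a \<Rightarrow> 'a) \<Rightarrow> ('a \<Rightarrow> 'a) \<Rightarrow> 'a \<Rightarrow> 'a::complex_hilbert" where
  "row_map r m S X = (\<lambda>x. \<Sum>s = 1..m. r\<^sup>2 *\<^sub>R S s (X (cadjoint (S s) x)))"

text \<open>\<open>\<Delta>\<^sub>r\<^sub>T(I) = (id - \<Phi>\<^sub>r\<^sub>T\<^sub>1)((id - \<Phi>\<^sub>r\<^sub>T\<^sub>2)(\<dots>(id - \<Phi>\<^sub>r\<^sub>T\<^sub>k)(I)\<dots>))\<close>; the case \<open>r = 1\<close> is \<open>\<Delta>\<^sub>T(I)\<close>.\<close>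

definition defect :: "real \<Rightarrow> nat \<Rightarrow> (nat \<Rightarrow> nat) \<Rightarrow> 'a op_tuple \<Rightarrow> 'a \<Rightarrow> 'a::complex_hilbert" where
  "defect r k n T = foldr (\<lambda>i X. (\<lambda>x. X x - row_map r (n i) (T i) X x)) [1..<Suc k] id"

definition polyball :: "nat \<Rightarrow> (nat \<Rightarrow> nat) \<Rightarrow> phases \<Rightarrow> 'a::complex_hilbert op_tuple set" where
  "polyball k n L = {T.
     (\<forall>i\<in>{1..k}. \<forall>s\<in>{1..n i}. bounded_clinear (T i s)) \<and>
     (\<forall>i\<in>{1..k}. op_le (\<lambda>x. \<Sum>s = 1..n i. T i s (cadjoint (T i s) x)) id) \<and>
     (\<forall>i\<in>{1..k}. \<forall>j\<in>{1..k}. i \<noteq> j \<longrightarrow> (\<forall>s\<in>{1..n i}. \<forall>t\<in>{1..n j}. \<forall>x.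
        T i s (T j t x) = L i j s t *\<^sub>C T j t (T i s x))) \<and>
     (\<forall>r. 0 \<le> r \<and> r < 1 \<longrightarrow> positive_op (defect r k n T))}"

definition pure_tuple :: "nat \<Rightarrow> (nat \<Rightarrow> nat) \<Rightarrow> 'a::complex_hilbert op_tuple \<Rightarrow> bool" where
  "pure_tuple k n T \<longleftrightarrow>
     (\<forall>i\<in>{1..k}. \<forall>x. (\<lambda>m. (row_map 1 (n i) (T i) ^^ m) id x) \<longlonglongrightarrow> 0)"

section \<open>Minimal dilations\<close>

definition doubly_commuting_row_isometries ::
  "nat \<Rightarrow> (nat \<Rightarrow> nat) \<Rightarrow> phases \<Rightarrow> 'a::complex_hilbert op_tuple \<Rightarrow> bool" where
  "doubly_commuting_row_isometries k n L V \<longleftrightarrow>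
     (\<forall>i\<in>{1..k}. \<forall>s\<in>{1..n i}. bounded_clinear (V i s)) \<and>
     (\<forall>i\<in>{1..k}. \<forall>s\<in>{1..n i}. \<forall>t\<in>{1..n i}. \<forall>x.
        cadjoint (V i s) (V i t x) = (if s = t then x else 0)) \<and>
     (\<forall>i\<in>{1..k}. \<forall>j\<in>{1..k}. i \<noteq> j \<longrightarrow> (\<forall>s\<in>{1..n i}. \<forall>t\<in>{1..n j}. \<forall>x.
        cadjoint (V i s) (V j t x) = cnj (L i j s t) *\<^sub>C V j t (cadjoint (V i s) x)))"

text \<open>Elements of the free semigroup on \<open>m\<close> generators are lists over \<open>{1..m}\<close>.\<close>

definition word_op :: "(nat \<Rightarrow> 'a \<Rightarrow> 'a) \<Rightarrow> nat list \<Rightarrow> 'a \<Rightarrow> 'a" where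
  "word_op S w = foldr (\<lambda>p A. S p \<circ> A) w id"

definition words_op :: "nat \<Rightarrow> 'a op_tuple \<Rightarrow> (nat \<Rightarrow> nat list) \<Rightarrow> 'a \<Rightarrow> 'a" where
  "words_op k V \<alpha> = foldr (\<lambda>i A. word_op (V i) (\<alpha> i) \<circ> A) [1..<Suc k] id"

text \<open>The inclusion of \<open>H\<close> in \<open>K\<close> is an isometric embedding \<open>J\<close>.\<close>

definition minimal_dilation ::
  "nat \<Rightarrow> (nat \<Rightarrow> nat) \<Rightarrow> phases \<Rightarrow> 'h::complex_hilbert op_tuple \<Rightarrow>
   ('h \<Rightarrow> 'k::complex_hilbert) \<Rightarrow> 'k op_tuple \<Rightarrow> bool" where
  "minimal_dilation k n L T J V \<longleftrightarrow>
     doubly_commuting_row_isometries k n L V \<and>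
     isometric_embedding J \<and>
     (\<forall>i\<in>{1..k}. \<forall>s\<in>{1..n i}. \<forall>h. J (cadjoint (T i s) h) = cadjoint (V i s) (J h)) \<and>
     closure (complex_vs.span
       {words_op k V \<alpha> (J h) | \<alpha> h. \<forall>i\<in>{1..k}. set (\<alpha> i) \<subseteq> {1..n i}}) = UNIV"

end

theory Submission imports Defs begin

text \<open>Each of the operators \<open>\<Phi>\<^bsub>T\<^sub>i\<^esub>\<^sup>m(I)\<close> and \<open>\<Delta>\<^sub>T(I)\<close> is the compression to \<open>H\<close> of the
  corresponding operator of the dilation, which is an orthogonal projection. Hence smallness
  for \<open>T\<close> amounts to smallness for \<open>V\<close> on the vectors of \<open>H\<close>. It propagates from \<open>H\<close> to \<open>K\<close>:
  \<open>\<Phi>\<^bsub>V\<^sub>i\<^esub>\<^sup>m\<^sup>+\<^sup>1(I) V\<^sub>i\<^sub>,\<^sub>s = V\<^sub>i\<^sub>,\<^sub>s \<Phi>\<^bsub>V\<^sub>i\<^esub>\<^sup>m(I)\<close> and \<open>\<Phi>\<^bsub>V\<^sub>i\<^esub>\<^sup>m(I)\<close> commutes with \<open>V\<^sub>j\<^sub>,\<^sub>t\<close> for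
  \<open>j \<noteq> i\<close>, so that the vectors on which these projections tend to \<open>0\<close> form a closed subspace
  invariant under all \<open>V\<^sub>j\<^sub>,\<^sub>t\<close>, while \<open>\<Delta>\<^sub>V(I) V\<^sub>j\<^sub>,\<^sub>t = 0\<close>. Finally \<open>V\<close> always lies in the polyball,
  because \<open>\<Delta>\<^sub>r\<^sub>V(I)\<close> is a product of commuting positive operators.\<close>

section \<open>Adjoints\<close>

lemma cinner_add_right: "cinner x (y + z) = cinner x y + cinner x z"
  by (metis cinner_commute cinner_add_left complex_cnj_add)

lemma cinner_scaleC_right: "cinner x (c *\<^sub>C y) = cnj c * cinner x y"
  by (metis cinner_commute cinner_scaleC_left complex_cnj_mult)

lemma cinner_scaleR_left: "cinner (r *\<^sub>R x) y = complex_of_real r * cinner x y"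
  by (metis cinner_scaleC_left scaleC_of_real)

lemma cinner_scaleR_right: "cinner x (r *\<^sub>R y) = complex_of_real r * cinner x y"
  by (metis cinner_scaleC_right scaleC_of_real complex_cnj_complex_of_real)

lemma cinner_zero_left [simp]: "cinner 0 x = 0"
  using cinner_add_left[of 0 0 x] by simp

lemma cinner_zero_right [simp]: "cinner x 0 = 0"
  using cinner_add_right[of x 0 0] by simp

lemma cinner_diff_left: "cinner (x - y) z = cinner x z - cinner y z"
  using cinner_add_left[of "x - y" y z] by simp

lemma cinner_diff_right: "cinner z (x - y) = cinner z x - cinner z y"
  using cinner_add_right[of z "x - y" y] by simp

lemma cinner_sum_left: "cinner (sum f S) y = (\<Sum>i\<in>S. cinner (f i) y)"
  by (induction S rule: infinite_finite_induct) (auto simp: cinner_add_left)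

lemma cinner_sum_right: "cinner y (sum f S) = (\<Sum>i\<in>S. cinner y (f i))"
  by (induction S rule: infinite_finite_induct) (auto simp: cinner_add_right)

lemma cinner_ext: "(\<And>z. cinner x z = cinner y z) \<Longrightarrow> x = y"
proof -
  assume *: "\<And>z. cinner x z = cinner y z"
  have "cinner (x - y) (x - y) = 0"
    by (simp add: * cinner_diff_left)
  then show "x = y"
    by (simp add: cinner_self)
qed

lemma Re_cinner_self: "Re (cinner x x) = (norm x)\<^sup>2"
  by (simp add: cinner_self)

lemma Re_cinner_commute: "Re (cinner x y) = Re (cinner y x)"
  by (metis cinner_commute complex_cnj(1) complex.exhaust_sel complex.sel(1))

lemma norm_add_cinner: "(norm (x + y))\<^sup>2 = (norm x)\<^sup>2 + 2 * Re (cinner x y) + (norm y)\<^sup>2"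
  using Re_cinner_commute[of y x]
  by (simp add: cinner_add_left cinner_add_right flip: Re_cinner_self)

lemma norm_diff_cinner: "(norm (x - y))\<^sup>2 = (norm x)\<^sup>2 - 2 * Re (cinner x y) + (norm y)\<^sup>2"
  using Re_cinner_commute[of y x]
  by (simp add: cinner_diff_left cinner_diff_right flip: Re_cinner_self)

text \<open>Cauchy-Schwarz for real parts: the norm is given with its triangle inequality, so it is
  enough to square that inequality and expand.\<close>

lemma Re_cinner_le: "Re (cinner x y) \<le> norm x * norm y"
proof -
  have "(norm (x + y))\<^sup>2 \<le> (norm x + norm y)\<^sup>2"
    by (simp add: norm_triangle_ineq power_mono)
  then show ?thesis
    by (simp add: norm_add_cinner power2_sum)
qed

lemma abs_Re_cinner_le: "\<bar>Re (cinner x y)\<bar> \<le> norm x * norm y"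
  using Re_cinner_le[of x y] Re_cinner_le[of "- x" y] cinner_diff_left[of 0 x y]
  by simp

text \<open>The representing vector minimises \<open>\<parallel>x\<parallel>\<^sup>2 - 2 f(x)\<close>; the parallelogram law makes minimising
  sequences Cauchy.\<close>

lemma riesz_Re:
  fixes f :: "'a::complex_hilbert \<Rightarrow> real"
  assumes f: "bounded_linear f"
  shows "\<exists>z. \<forall>x. f x = Re (cinner x z)"
proof -
  interpret f: bounded_linear f by (rule f)
  define g where "g = (\<lambda>x. (norm x)\<^sup>2 - 2 * f x)"
  obtain C where C: "\<And>x. norm (f x) \<le> norm x * C"
    using f.bounded by blast
  have lower: "- C\<^sup>2 \<le> g x" for x
  proof -
    \<comment> \<open>Completing the square in \<open>(norm x)^2 - 2 * norm x * C\<close>.\<close>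
    have "0 \<le> (norm x - C)\<^sup>2" by simp
    moreover have "f x \<le> norm x * C"
      using C[of x] by simp
    ultimately show ?thesis
      by (simp add: g_def power2_diff)
  qed
  define m where "m = (INF x. g x)"
  have bdd: "bdd_below (range g)"
    using lower by (intro bdd_belowI[of _ "- C\<^sup>2"]) auto
  have m_le: "m \<le> g x" for x
    unfolding m_def by (rule cINF_lower[OF bdd]) simp
  have "\<exists>x. g x < m + inverse (real (Suc j))" for j
    using cInf_lessD[of "range g" "m + inverse (real (Suc j))"] by (auto simp: m_def)
  then obtain X where X: "\<And>j. g (X j) < m + inverse (real (Suc j))"
    by metis
  have para: "(norm (x - y))\<^sup>2 \<le> 2 * (g x - m) + 2 * (g y - m)" for x y
  proof -
    \<comment> \<open>The midpoint cannot take \<open>g\<close> below its infimum; by the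
      parallelogram law this bounds the distance of \<open>x\<close> and \<open>y\<close>.\<close>
    have "g ((1/2) *\<^sub>R (x + y)) = (norm (x + y))\<^sup>2 / 4 - (f x + f y)"
      by (simp add: g_def f.scaleR f.add power_divide add_divide_distrib)
    then have "4 * m \<le> (norm (x + y))\<^sup>2 - 4 * (f x + f y)"
      using m_le[of "(1/2) *\<^sub>R (x + y)"] by simp
    then show ?thesis
      by (simp add: g_def norm_add_cinner norm_diff_cinner)
  qed
  have "Cauchy X"
  proof (rule metric_CauchyI)
    fix e :: real assume "e > 0"
    then obtain N where N: "inverse (real (Suc N)) < e\<^sup>2 / 4"
      using reals_Archimedean[of "e\<^sup>2 / 4"] by auto
    have small: "g (X j) - m < e\<^sup>2 / 4" if "j \<ge> N" for j
    proof -
      have "inverse (real (Suc j)) \<le> inverse (real (Suc N))"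
        using that by (simp add: le_imp_inverse_le)
      then show ?thesis using X[of j] N by linarith
    qed
    have "dist (X i) (X j) < e" if "i \<ge> N" "j \<ge> N" for i j
    proof -
      have "(norm (X i - X j))\<^sup>2 < e\<^sup>2"
        using para[of "X i" "X j"] small[OF that(1)] small[OF that(2)] by simp
      then show ?thesis
        using \<open>e > 0\<close> by (simp add: dist_norm power_less_imp_less_base)
    qed
    then show "\<exists>M. \<forall>i\<ge>M. \<forall>j\<ge>M. dist (X i) (X j) < e" by blast
  qed
  then obtain z where z: "X \<longlonglongrightarrow> z"
    using Cauchy_convergent_iff convergent_def by blast
  have "(\<lambda>j. g (X j)) \<longlonglongrightarrow> g z"
    unfolding g_def by (intro tendsto_intros z f.tendsto)
  moreover have "(\<lambda>j. m + inverse (real (Suc j))) \<longlonglongrightarrow> m"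
    using tendsto_add[OF tendsto_const LIMSEQ_inverse_real_of_nat, of m] by simp
  ultimately have gz: "g z \<le> m"
    by (rule LIMSEQ_le) (use X less_imp_le in blast)
  have "f y = Re (cinner y z)" for y
  proof (rule ccontr)
    define d where "d = f y - Re (cinner y z)"
    \<comment> \<open>A step of length \<open>t\<close> along \<open>y\<close> lowers
      \<open>g\<close> below its minimum, because \<open>t * d = t^2 * ((norm y)^2 + 1)\<close>
      exceeds \<open>t^2 * (norm y)^2 / 2\<close>. The summand 1 keeps the denominator positive when
      \<open>y = 0\<close>.\<close>
    define t where "t = d / ((norm y)\<^sup>2 + 1)"
    assume "f y \<noteq> Re (cinner y z)"
    then have d: "d \<noteq> 0" by (simp add: d_def)
    have pos: "(norm y)\<^sup>2 + 1 > 0"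
      by (simp add: add_nonneg_pos)
    have "g (z + t *\<^sub>R y) = g z + t\<^sup>2 * (norm y)\<^sup>2 - 2 * t * d"
      by (simp add: g_def d_def norm_add_cinner cinner_scaleR_right f.add f.scaleR
          power_mult_distrib Re_cinner_commute[of z y] algebra_simps)
    then have "2 * t * d \<le> t\<^sup>2 * (norm y)\<^sup>2"
      using gz m_le[of "z + t *\<^sub>R y"] by simp
    moreover have "t * d = t\<^sup>2 * ((norm y)\<^sup>2 + 1)"
      using pos by (simp add: t_def power2_eq_square)
    moreover have "t\<^sup>2 > 0"
      using d pos by (simp add: t_def)
    moreover have "t\<^sup>2 * (norm y)\<^sup>2 \<ge> 0" by simp
    ultimately show False
      by (simp add: distrib_left)
  qed
  then show ?thesis by blast
qed

text \<open>A relation, so that adjoints can be handled without the definite description in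
  \<open>cadjoint\<close>. Having an adjoint already forces linearity;
  \<open>adjoint_pair X X\<close> says that \<open>X\<close> is self-adjoint.\<close>

definition adjoint_pair :: "('a::complex_hilbert \<Rightarrow> 'b::complex_hilbert) \<Rightarrow> ('b \<Rightarrow> 'a) \<Rightarrow> bool" where
  "adjoint_pair A B \<longleftrightarrow> (\<forall>x y. cinner (A x) y = cinner x (B y))"

lemma adjoint_pairD: "adjoint_pair A B \<Longrightarrow> cinner (A x) y = cinner x (B y)"
  by (simp add: adjoint_pair_def)

lemma adjoint_pair_sym: "adjoint_pair A B \<Longrightarrow> adjoint_pair B A"
  unfolding adjoint_pair_def by (metis cinner_commute)

lemma adjoint_pair_add: "adjoint_pair A B \<Longrightarrow> A (x + y) = A x + A y"
  by (rule cinner_ext) (simp add: adjoint_pairD cinner_add_left)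

lemma adjoint_pair_diff: "adjoint_pair A B \<Longrightarrow> A (x - y) = A x - A y"
  by (rule cinner_ext) (simp add: adjoint_pairD cinner_diff_left)

lemma adjoint_pair_zero: "adjoint_pair A B \<Longrightarrow> A 0 = 0"
  by (rule cinner_ext) (simp add: adjoint_pairD)

lemma adjoint_pair_scaleC: "adjoint_pair A B \<Longrightarrow> A (c *\<^sub>C x) = c *\<^sub>C A x"
  by (rule cinner_ext) (simp add: adjoint_pairD cinner_scaleC_left)

lemma adjoint_pair_scaleR: "adjoint_pair A B \<Longrightarrow> A (r *\<^sub>R x) = r *\<^sub>R A x"
  by (rule cinner_ext) (simp add: adjoint_pairD cinner_scaleR_left)

lemma adjoint_pair_sum: "adjoint_pair A B \<Longrightarrow> A (sum f S) = (\<Sum>i\<in>S. A (f i))"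
  by (rule cinner_ext) (simp add: adjoint_pairD cinner_sum_left)

text \<open>Riesz representation of the real part of \<open>cinner (A x) y\<close> yields an
  adjoint, and its uniqueness identifies it with the description in \<open>cadjoint\<close>.\<close>

lemma adjoint_pair_cadjoint:
  fixes A :: "'a::complex_hilbert \<Rightarrow> 'a"
  assumes A: "bounded_clinear A"
  shows "adjoint_pair A (cadjoint A)"
proof -
  interpret A: bounded_linear A
    using A by (simp add: bounded_clinear_def)
  have "\<exists>z. \<forall>x. cinner (A x) y = cinner x z" for y
  proof -
    obtain C where C: "\<And>x. norm (A x) \<le> norm x * C"
      using A.bounded by blast
    have "bounded_linear (\<lambda>x. Re (cinner (A x) y))"
    proof (rule bounded_linear_intro)
      show "norm (Re (cinner (A x) y)) \<le> norm x * (C * norm y)" for x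
        using abs_Re_cinner_le[of "A x" y] mult_right_mono[OF C[of x] norm_ge_zero[of y]]
        by (simp add: mult.assoc)
    qed (simp_all add: A.add A.scaleR cinner_add_left cinner_scaleR_left)
    then obtain z where z: "\<And>x. Re (cinner (A x) y) = Re (cinner x z)"
      using riesz_Re by blast
    \<comment> \<open>The imaginary part of \<open>w\<close> is the real part of
      \<open>-i w\<close>, so complex linearity reduces it to the real part.\<close>
    have "Im (cinner (A x) y) = Im (cinner x z)" for x
      using z[of "(- \<i>) *\<^sub>C x"] A by (simp add: bounded_clinear_def cinner_scaleC_left
          del: complex_vs.scale_minus_left)
    with z show ?thesis
      by (auto intro!: exI[of _ z] complex_eqI)
  qed
  then obtain B where B: "\<forall>x y. cinner (A x) y = cinner x (B y)"
    by metis
  have "cadjoint A = B"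
    unfolding cadjoint_def
  proof (rule the_equality)
    show "\<forall>x y. cinner (A x) y = cinner x (B y)" by (rule B)
    fix B' assume "\<forall>x y. cinner (A x) y = cinner x (B' y)"
    then have *: "cinner (B' y) x = cinner (B y) x" for x y
      using B cinner_commute[of "B' y" x] cinner_commute[of "B y" x] by simp
    show "B' = B"
      by (rule ext, rule cinner_ext) (rule *)
  qed
  with B show ?thesis
    by (simp add: adjoint_pair_def)
qed

section \<open>Orthogonal projections\<close>

definition orth_proj :: "('a::complex_hilbert \<Rightarrow> 'a) \<Rightarrow> bool" where
  "orth_proj Q \<longleftrightarrow> adjoint_pair Q Q \<and> (\<forall>x. Q (Q x) = Q x)"

lemma orth_proj_cinner: "orth_proj Q \<Longrightarrow> cinner (Q x) x = complex_of_real ((norm (Q x))\<^sup>2)"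
  unfolding orth_proj_def by (metis adjoint_pairD cinner_self)

lemma orth_proj_diff: "orth_proj Q \<Longrightarrow> orth_proj (\<lambda>x. x - Q x)"
  by (auto simp: orth_proj_def adjoint_pair_def cinner_diff_left cinner_diff_right
      adjoint_pair_diff[of Q Q])

lemma orth_proj_norm_le:
  assumes "orth_proj Q"
  shows "norm (Q x) \<le> norm x"
proof -
  have "(norm (Q x))\<^sup>2 \<le> norm (Q x) * norm x"
    using Re_cinner_le[of "Q x" x] orth_proj_cinner[OF assms, of x] by simp
  then show ?thesis
    by (cases "Q x = 0") (auto simp: power2_eq_square)
qed

section \<open>Completely positive maps of rows\<close>

lemma adjoint_pair_row_map:
  assumes "\<And>s. s \<in> {1..m} \<Longrightarrow> adjoint_pair (S s) (cadjoint (S s))" and "adjoint_pair X X"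
  shows "adjoint_pair (row_map r m S X) (row_map r m S X)"
  unfolding adjoint_pair_def
proof (intro allI)
  fix x y
  have "cinner (S s (X (cadjoint (S s) x))) y = cinner x (S s (X (cadjoint (S s) y)))"
    if "s \<in> {1..m}" for s
    using assms(1)[OF that] assms(2)
    by (metis adjoint_pairD adjoint_pair_sym)
  then show "cinner (row_map r m S X x) y = cinner x (row_map r m S X y)"
    by (simp add: row_map_def cinner_sum_left cinner_sum_right cinner_scaleR_left
        cinner_scaleR_right)
qed

section \<open>Compression from the dilation space to \<open>H\<close>\<close>

locale row_dilation =
  fixes k :: nat and n :: "nat \<Rightarrow> nat"
    and T :: "'h::complex_hilbert op_tuple"
    and V :: "'k::complex_hilbert op_tuple"
    and J :: "'h \<Rightarrow> 'k"
  assumes J: "isometric_embedding J"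
    and T_clinear: "\<And>i s. i \<in> {1..k} \<Longrightarrow> s \<in> {1..n i} \<Longrightarrow> bounded_clinear (T i s)"
    and V_clinear: "\<And>i s. i \<in> {1..k} \<Longrightarrow> s \<in> {1..n i} \<Longrightarrow> bounded_clinear (V i s)"
    and intertwine: "\<And>i s h. i \<in> {1..k} \<Longrightarrow> s \<in> {1..n i} \<Longrightarrow>
           J (cadjoint (T i s) h) = cadjoint (V i s) (J h)"
begin

text \<open>The identity \<open>X = J^* Y J\<close> in weak form; \<open>cadjoint\<close> is
  reserved for maps of a space into itself.\<close>

definition compression :: "('h \<Rightarrow> 'h) \<Rightarrow> ('k \<Rightarrow> 'k) \<Rightarrow> bool" where
  "compression X Y \<longleftrightarrow> (\<forall>x y. cinner (X x) y = cinner (Y (J x)) (J y))"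

lemma compression_id: "compression id id"
  using J by (simp add: compression_def isometric_embedding_def)

text \<open>Moving the outer \<open>T i s\<close> and \<open>V i s\<close> to the right-hand
  argument leaves adjoints on both sides of \<open>X\<close> and \<open>Y\<close>, where
  \<open>J T^* = V^* J\<close> applies.\<close>

lemma compression_row_map:
  assumes "compression X Y" "i \<in> {1..k}"
  shows "compression (row_map r (n i) (T i) X) (row_map r (n i) (V i) Y)"
  unfolding compression_def
proof (intro allI)
  fix x y
  have "cinner (T i s (X (cadjoint (T i s) x))) y =
      cinner (V i s (Y (cadjoint (V i s) (J x)))) (J y)" if s: "s \<in> {1..n i}" for s
    using assms(1) adjoint_pairD[OF adjoint_pair_cadjoint[OF T_clinear[OF assms(2) s]]]
      adjoint_pairD[OF adjoint_pair_cadjoint[OF V_clinear[OF assms(2) s]]]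
      intertwine[OF assms(2) s]
    by (simp add: compression_def)
  then show "cinner (row_map r (n i) (T i) X x) y = cinner (row_map r (n i) (V i) Y (J x)) (J y)"
    by (simp add: row_map_def cinner_sum_left cinner_scaleR_left)
qed

lemma compression_funpow:
  "i \<in> {1..k} \<Longrightarrow>
    compression ((row_map r (n i) (T i) ^^ m) id) ((row_map r (n i) (V i) ^^ m) id)"
  by (induction m) (auto intro: compression_row_map compression_id[unfolded id_def] simp: id_def)

lemma compression_defect: "compression (defect r k n T) (defect r k n V)"
proof -
  have "compression
      (foldr (\<lambda>i X. (\<lambda>x. X x - row_map r (n i) (T i) X x)) is id)
      (foldr (\<lambda>i X. (\<lambda>x. X x - row_map r (n i) (V i) X x)) is id)"
    if "set is \<subseteq> {1..k}" for "is"
    using that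
  proof (induction "is")
    case Nil
    then show ?case using compression_id by (simp add: id_def)
  next
    case (Cons i "is")
    then have "compression
        (foldr (\<lambda>i X. (\<lambda>x. X x - row_map r (n i) (T i) X x)) is id)
        (foldr (\<lambda>i X. (\<lambda>x. X x - row_map r (n i) (V i) X x)) is id)" (is "compression ?X ?Y")
      by (intro Cons.IH) auto
    moreover from this
    have "compression (row_map r (n i) (T i) ?X) (row_map r (n i) (V i) ?Y)"
      using Cons.prems by (intro compression_row_map) auto
    ultimately show ?case
      by (simp add: compression_def cinner_diff_left id_def)
  qed
  moreover have "set [1..<Suc k] \<subseteq> {1..k}" by auto
  ultimately show ?thesis
    unfolding defect_def by blast
qed

text \<open>Test the compression identity against \<open>X x\<close> and use that \<open>J\<close>
  preserves norms.\<close>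

lemma compression_norm_le:
  assumes "compression X Y"
  shows "norm (X x) \<le> norm (Y (J x))"
proof -
  have "norm (J (X x)) = norm (X x)"
    using J Re_cinner_self[of "J (X x)"] Re_cinner_self[of "X x"]
    by (simp add: isometric_embedding_def)
  then have "(norm (X x))\<^sup>2 \<le> norm (Y (J x)) * norm (X x)"
    using Re_cinner_le[of "Y (J x)" "J (X x)"] assms Re_cinner_self[of "X x"]
    by (simp add: compression_def)
  then show ?thesis
    by (cases "X x = 0") (auto simp: power2_eq_square)
qed

text \<open>The bound in the opposite direction, at the price of a square: for a projection
  \<open>Y\<close>, the form at \<open>J x\<close> is the squared norm of
  \<open>Y (J x)\<close>.\<close>

lemma compression_orth_proj_norm_le:
  assumes "compression X Y" "orth_proj Y"
  shows "(norm (Y (J x)))\<^sup>2 \<le> norm (X x) * norm x"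
proof -
  have "(norm (Y (J x)))\<^sup>2 = Re (cinner (X x) x)"
    using assms orth_proj_cinner[OF assms(2), of "J x"] by (simp add: compression_def)
  then show ?thesis
    using Re_cinner_le[of "X x" x] by simp
qed

end

section \<open>Doubly commuting row isometries\<close>

locale doubly_commuting =
  fixes k :: nat and n :: "nat \<Rightarrow> nat" and L :: phases
    and V :: "'k::complex_hilbert op_tuple"
  assumes cmod_L: "\<And>i j s t. i \<in> {1..k} \<Longrightarrow> j \<in> {1..k} \<Longrightarrow> i \<noteq> j \<Longrightarrow>
           s \<in> {1..n i} \<Longrightarrow> t \<in> {1..n j} \<Longrightarrow> cmod (L i j s t) = 1"
    and cnj_L: "\<And>i j s t. i \<in> {1..k} \<Longrightarrow> j \<in> {1..k} \<Longrightarrow> i \<noteq> j \<Longrightarrow>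
           s \<in> {1..n i} \<Longrightarrow> t \<in> {1..n j} \<Longrightarrow> L j i t s = cnj (L i j s t)"
    and V: "doubly_commuting_row_isometries k n L V"
begin

abbreviation VS :: "nat \<Rightarrow> nat \<Rightarrow> 'k \<Rightarrow> 'k" where
  "VS i s \<equiv> cadjoint (V i s)"

abbreviation \<Phi> :: "real \<Rightarrow> nat \<Rightarrow> ('k \<Rightarrow> 'k) \<Rightarrow> 'k \<Rightarrow> 'k" where
  "\<Phi> r i \<equiv> row_map r (n i) (V i)"

lemma V_clinear: "i \<in> {1..k} \<Longrightarrow> s \<in> {1..n i} \<Longrightarrow> bounded_clinear (V i s)"
  using V by (simp add: doubly_commuting_row_isometries_def)

lemma V_adj: "i \<in> {1..k} \<Longrightarrow> s \<in> {1..n i} \<Longrightarrow> adjoint_pair (V i s) (VS i s)"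
  by (intro adjoint_pair_cadjoint V_clinear)

lemma VS_V: "i \<in> {1..k} \<Longrightarrow> s \<in> {1..n i} \<Longrightarrow> t \<in> {1..n i} \<Longrightarrow>
    VS i s (V i t x) = (if s = t then x else 0)"
  using V by (simp add: doubly_commuting_row_isometries_def)

lemma VS_V_cross: "i \<in> {1..k} \<Longrightarrow> j \<in> {1..k} \<Longrightarrow> i \<noteq> j \<Longrightarrow> s \<in> {1..n i} \<Longrightarrow> t \<in> {1..n j} \<Longrightarrow>
    VS i s (V j t x) = cnj (L i j s t) *\<^sub>C V j t (VS i s x)"
  using V by (simp add: doubly_commuting_row_isometries_def)

text \<open>With \<open>D = V\<^sub>i\<^sub>,\<^sub>s V\<^sub>j\<^sub>,\<^sub>t - \<lambda> V\<^sub>j\<^sub>,\<^sub>t V\<^sub>i\<^sub>,\<^sub>s\<close>, the relations \<open>V\<^sub>i\<^sub>,\<^sub>s\<^sup>* V\<^sub>j\<^sub>,\<^sub>t = \<lambda>' V\<^sub>j\<^sub>,\<^sub>t V\<^sub>i\<^sub>,\<^sub>s\<^sup>*\<close> for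
  \<open>\<lambda>'\<close> the conjugate of \<open>\<lambda>\<close> give \<open>D\<^sup>* D = 0\<close>.\<close>

lemma V_V_cross:
  assumes i: "i \<in> {1..k}" and j: "j \<in> {1..k}" and ij: "i \<noteq> j"
    and s: "s \<in> {1..n i}" and t: "t \<in> {1..n j}"
  shows "V i s (V j t x) = L i j s t *\<^sub>C V j t (V i s x)"
proof -
  let ?l = "L i j s t"
  let ?a = "V i s (V j t x)" and ?b = "?l *\<^sub>C V j t (V i s x)"
  have l: "cnj ?l * ?l = 1" "?l * cnj ?l = 1"
    using cmod_L[OF i j ij s t] complex_norm_square[of ?l] by (simp_all add: mult.commute)
  have iso: "cinner (V i s u) (V i s v) = cinner u v" "cinner (V j t u) (V j t v) = cinner u v" for u v
    using i j s t by (simp_all add: adjoint_pairD[OF V_adj] VS_V)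
  have "cinner ?b ?a = ?l * cinner (V i s x) (VS j t (V i s (V j t x)))"
    by (simp add: cinner_scaleC_left adjoint_pairD[OF V_adj[OF j t]])
  also have "VS j t (V i s (V j t x)) = ?l *\<^sub>C V i s x"
    using VS_V_cross[OF j i ij[symmetric] t s, of "V j t x"] cnj_L[OF i j ij s t] j t
    by (simp add: VS_V)
  finally have ba: "cinner ?b ?a = cinner x x"
    using l by (simp add: cinner_scaleC_right iso flip: mult.assoc)
  then have ab: "cinner ?a ?b = cinner x x"
    by (metis cinner_commute)
  have "cinner (?a - ?b) (?a - ?b) = 0"
    using l by (simp add: cinner_diff_left cinner_diff_right ba ab)
      (simp add: cinner_scaleC_left cinner_scaleC_right iso flip: mult.assoc)
  then show ?thesis
    by (simp add: cinner_self)
qed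

section \<open>Row maps of \<open>V\<close> and their iterates\<close>

lemma row_map_adj: "i \<in> {1..k} \<Longrightarrow> adjoint_pair X X \<Longrightarrow> adjoint_pair (\<Phi> r i X) (\<Phi> r i X)"
  by (intro adjoint_pair_row_map V_adj)

text \<open>Moving \<open>V j t\<close> past \<open>V i s^*\<close> costs the conjugate of
  \<open>L i j s t\<close>, moving it past \<open>V i s\<close> costs \<open>L i j s t\<close>, and
  these phases cancel.\<close>

lemma row_map_commute:
  assumes i: "i \<in> {1..k}" and j: "j \<in> {1..k}" and ij: "i \<noteq> j" and t: "t \<in> {1..n j}"
    and X: "adjoint_pair X X" and comm: "\<And>x. X (V j t x) = V j t (X x)"
  shows "\<Phi> r i X (V j t x) = V j t (\<Phi> r i X x)"
proof -
  have "V i s (X (VS i s (V j t x))) = V j t (V i s (X (VS i s x)))" if s: "s \<in> {1..n i}" for s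
  proof -
    have "cnj (L i j s t) * L i j s t = 1"
      using cmod_L[OF i j ij s t] complex_norm_square[of "L i j s t"] by (simp add: mult.commute)
    then show ?thesis
      by (simp add: VS_V_cross[OF i j ij s t] adjoint_pair_scaleC[OF X] comm
          adjoint_pair_scaleC[OF V_adj[OF i s]] V_V_cross[OF i j ij s t] scaleC_scaleC)
  qed
  then show ?thesis
    by (simp add: row_map_def adjoint_pair_sum[OF V_adj[OF j t]]
        adjoint_pair_scaleR[OF V_adj[OF j t]])
qed

text \<open>The ranges within a row are orthogonal, so only the summand with index \<open>s\<close>
  survives.\<close>

lemma row_map_V:
  assumes "i \<in> {1..k}" "s \<in> {1..n i}" "adjoint_pair X X"
  shows "\<Phi> 1 i X (V i s x) = V i s (X x)"
proof -
  have "\<Phi> 1 i X (V i s x) = (\<Sum>t = 1..n i. if t = s then V i s (X x) else 0)"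
    unfolding row_map_def using assms
    by (intro sum.cong) (auto simp: VS_V adjoint_pair_zero[OF assms(3)] adjoint_pair_zero[OF V_adj])
  then show ?thesis
    using assms(2) by simp
qed

text \<open>Expanding only the inner map gives a sum of vectors \<open>V i s (X (VS i s x))\<close>;
  on each of them \<open>row_map_V\<close> replaces the outer map by a second \<open>X\<close>,
  which is absorbed.\<close>

lemma row_map_orth_proj:
  assumes i: "i \<in> {1..k}" and X: "orth_proj X"
  shows "orth_proj (\<Phi> 1 i X)"
proof -
  have X': "adjoint_pair X X" using X by (simp add: orth_proj_def)
  have P: "adjoint_pair (\<Phi> 1 i X) (\<Phi> 1 i X)"
    using i X' by (rule row_map_adj)
  have "\<Phi> 1 i X (\<Phi> 1 i X x) = (\<Sum>s = 1..n i. \<Phi> 1 i X (V i s (X (VS i s x))))" for x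
    by (subst (2) row_map_def) (simp add: adjoint_pair_sum[OF P])
  also have "\<dots> x = \<Phi> 1 i X x" for x
    using X by (subst (2) row_map_def) (simp add: row_map_V[OF i _ X'] orth_proj_def)
  finally show ?thesis
    using P by (simp add: orth_proj_def)
qed

lemma orth_proj_id: "orth_proj id"
  by (simp add: orth_proj_def adjoint_pair_def)

lemma funpow_orth_proj: "i \<in> {1..k} \<Longrightarrow> orth_proj ((\<Phi> 1 i ^^ m) id)"
  by (induction m) (auto intro: row_map_orth_proj orth_proj_id[unfolded id_def] simp: id_def)

lemma funpow_commute:
  assumes "i \<in> {1..k}" "j \<in> {1..k}" "i \<noteq> j" "t \<in> {1..n j}"
  shows "(\<Phi> 1 i ^^ m) id (V j t x) = V j t ((\<Phi> 1 i ^^ m) id x)"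
proof (induction m arbitrary: x)
  case (Suc m)
  have "adjoint_pair ((\<Phi> 1 i ^^ m) id) ((\<Phi> 1 i ^^ m) id)"
    using funpow_orth_proj[OF assms(1)] by (simp add: orth_proj_def)
  then show ?case
    unfolding funpow.simps o_apply using Suc by (rule row_map_commute[OF assms])
qed simp

text \<open>For \<open>i\<close> in \<open>{1..k}\<close>, the projection onto the orthogonal sum of
  the ranges of the \<open>V i s\<close>.\<close>

definition range_proj :: "nat \<Rightarrow> 'k \<Rightarrow> 'k" where
  "range_proj i = \<Phi> 1 i id"

lemma range_proj: "i \<in> {1..k} \<Longrightarrow> orth_proj (range_proj i)"
  unfolding range_proj_def by (intro row_map_orth_proj orth_proj_id)

lemma range_proj_commute:
  assumes "i \<in> {1..k}" "j \<in> {1..k}" "i \<noteq> j" "t \<in> {1..n j}"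
  shows "range_proj i (V j t x) = V j t (range_proj i x)"
  using funpow_commute[OF assms, of 1 x] by (simp add: range_proj_def)

lemma range_proj_V:
  "i \<in> {1..k} \<Longrightarrow> s \<in> {1..n i} \<Longrightarrow> range_proj i (V i s x) = V i s x"
  unfolding range_proj_def using orth_proj_id row_map_V[of i s id x] by (simp add: orth_proj_def)

section \<open>Defect operators of \<open>V\<close>, for arbitrary lists of indices to permit
  induction\<close>

definition partial_defect :: "real \<Rightarrow> nat list \<Rightarrow> 'k \<Rightarrow> 'k" where
  "partial_defect r is = foldr (\<lambda>i X. (\<lambda>x. X x - \<Phi> r i X x)) is id"

text \<open>An \<open>X\<close> commuting with the row can be pulled out of the sum, so the row map
  becomes multiplication by \<open>r^2\<close> times the range projection.\<close>

lemma commuting_factor: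
  assumes i: "i \<in> {1..k}" and X: "adjoint_pair X X"
    and comm: "\<And>s x. s \<in> {1..n i} \<Longrightarrow> X (V i s x) = V i s (X x)"
  shows "\<Phi> r i X x = r\<^sup>2 *\<^sub>R X (range_proj i x)"
    and "X (range_proj i x) = range_proj i (X x)"
proof -
  \<comment> \<open>The adjoint of the relation \<open>comm\<close>, as \<open>X\<close> is
    self-adjoint.\<close>
  have comm': "X (VS i s x) = VS i s (X x)" if s: "s \<in> {1..n i}" for s x
  proof (rule cinner_ext)
    fix z
    have "cinner (X (VS i s x)) z = cinner x (V i s (X z))"
      by (simp add: adjoint_pairD[OF X] adjoint_pairD[OF adjoint_pair_sym[OF V_adj[OF i s]]])
    also have "\<dots> = cinner (VS i s (X x)) z"
      by (simp add: adjoint_pairD[OF X] adjoint_pairD[OF adjoint_pair_sym[OF V_adj[OF i s]]]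
          comm[OF s, symmetric])
    finally show "cinner (X (VS i s x)) z = cinner (VS i s (X x)) z" .
  qed
  show "\<Phi> r i X x = r\<^sup>2 *\<^sub>R X (range_proj i x)"
    by (simp add: row_map_def range_proj_def adjoint_pair_sum[OF X] comm scaleR_sum_right)
  show "X (range_proj i x) = range_proj i (X x)"
    by (simp add: row_map_def range_proj_def adjoint_pair_sum[OF X] comm comm')
qed

text \<open>Both claims go through one induction: the commutation step via
  \<open>row_map_commute\<close> requires self-adjointness of the shorter defect.\<close>

lemma partial_defect_props:
  assumes "distinct is" "set is \<subseteq> {1..k}"
  shows "adjoint_pair (partial_defect r is) (partial_defect r is)"
    and "j \<in> {1..k} - set is \<Longrightarrow> t \<in> {1..n j} \<Longrightarrow>
      partial_defect r is (V j t x) = V j t (partial_defect r is x)"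
  using assms
proof (induction "is" arbitrary: j t x)
  case Nil
  {
    case 1
    show ?case using orth_proj_id by (simp add: partial_defect_def orth_proj_def id_def)
  next
    case 2
    then show ?case by (simp add: partial_defect_def)
  }
next
  case (Cons i "is")
  have i: "i \<in> {1..k}" and "distinct is" "set is \<subseteq> {1..k}" "i \<notin> set is"
    if "distinct (i # is)" "set (i # is) \<subseteq> {1..k}"
    using that by auto
  have eq: "partial_defect r (i # is) =
      (\<lambda>x. partial_defect r is x - \<Phi> r i (partial_defect r is) x)"
    by (simp add: partial_defect_def)
  {
    case 1
    then show ?case
      using Cons.IH(1) row_map_adj[of i "partial_defect r is" r]
      by (auto simp: eq adjoint_pair_def cinner_diff_left cinner_diff_right)
  next
    case 2
    then have "\<Phi> r i (partial_defect r is) (V j t x) = V j t (\<Phi> r i (partial_defect r is) x)"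
      using Cons.IH by (intro row_map_commute) auto
    moreover have "adjoint_pair (V j t) (VS j t)"
      using 2 by (intro V_adj) auto
    ultimately show ?case
      using 2 Cons.IH(2)[of j t] by (simp add: eq adjoint_pair_diff)
  }
qed

text \<open>Splits off the factor \<open>I - r^2 P\<close> with \<open>P = range_proj i\<close>.
  Distinctness keeps \<open>i\<close> out of the tail, whose defect therefore commutes with
  \<open>V i s\<close>.\<close>

lemma partial_defect_Cons:
  assumes "distinct (i # is)" "set (i # is) \<subseteq> {1..k}"
  shows "partial_defect r (i # is) x =
      partial_defect r is (x - r\<^sup>2 *\<^sub>R range_proj i x)"
    and "partial_defect r is (range_proj i x) = range_proj i (partial_defect r is x)"
proof -
  have i: "i \<in> {1..k}" and X: "adjoint_pair (partial_defect r is) (partial_defect r is)"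
    and comm: "\<And>s x. s \<in> {1..n i} \<Longrightarrow>
        partial_defect r is (V i s x) = V i s (partial_defect r is x)"
    using assms partial_defect_props[of "is"] by auto
  show "partial_defect r is (range_proj i x) = range_proj i (partial_defect r is x)"
    using i X comm by (rule commuting_factor)
  have "partial_defect r (i # is) x =
      partial_defect r is x - \<Phi> r i (partial_defect r is) x"
    by (simp add: partial_defect_def)
  then show "partial_defect r (i # is) x = partial_defect r is (x - r\<^sup>2 *\<^sub>R range_proj i x)"
    using commuting_factor(1)[OF i X comm, of r x]
    by (simp add: adjoint_pair_diff[OF X] adjoint_pair_scaleR[OF X])
qed

text \<open>For a projection \<open>P\<close>, the operator \<open>I - r\<^sup>2 P\<close> is the square of \<open>I - c P\<close> with
  \<open>c = 1 - \<surd>(1 - r\<^sup>2)\<close>.\<close>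

lemma partial_defect_positive:
  assumes "distinct is" "set is \<subseteq> {1..k}" "0 \<le> r" "r < 1"
  shows "positive_op (partial_defect r is)"
  using assms
proof (induction "is")
  case Nil
  then show ?case
    by (simp add: partial_defect_def positive_op_def cinner_self del: of_real_power)
next
  case (Cons i "is")
  let ?X = "partial_defect r is"
  define c where "c = 1 - sqrt (1 - r\<^sup>2)"
  define A where "A = (\<lambda>x. x - c *\<^sub>R range_proj i x)"
  have "r\<^sup>2 \<le> 1"
    using Cons.prems by (simp add: power_le_one)
  then have c: "2 * c - c * c = r\<^sup>2"
    by (simp add: c_def algebra_simps)
  have P: "orth_proj (range_proj i)"
    using Cons.prems by (intro range_proj) auto
  then have P': "adjoint_pair (range_proj i) (range_proj i)"
    and PP: "range_proj i (range_proj i x) = range_proj i x" for x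
    by (simp_all add: orth_proj_def)
  have X: "adjoint_pair ?X ?X"
    using Cons.prems by (intro partial_defect_props) auto
  have A: "adjoint_pair A A"
    using P' by (simp add: A_def adjoint_pair_def cinner_diff_left cinner_diff_right
        cinner_scaleR_left cinner_scaleR_right)
  have AA: "A (A x) = x - r\<^sup>2 *\<^sub>R range_proj i x" for x
    by (simp add: A_def adjoint_pair_diff[OF P'] adjoint_pair_scaleR[OF P'] PP
        scaleR_diff_right algebra_simps flip: c)
      (simp flip: scaleR_add_left)
  have XA: "?X (A x) = A (?X x)" for x
    using partial_defect_Cons(2)[OF Cons.prems(1,2)]
    by (simp add: A_def adjoint_pair_diff[OF X] adjoint_pair_scaleR[OF X])
  \<comment> \<open>Since \<open>A\<close> commutes with \<open>?X\<close>, the operator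
    \<open>?X A A\<close> equals \<open>A ?X A\<close>, whose form is that of \<open>?X\<close> at
    \<open>A x\<close>.\<close>
  have "cinner (partial_defect r (i # is) x) x = cinner (?X (A x)) (A x)" for x
    using partial_defect_Cons(1)[OF Cons.prems(1,2)]
    by (simp add: AA[symmetric] XA adjoint_pairD[OF A])
  moreover have "positive_op ?X"
    using Cons by simp
  ultimately show ?case
    by (simp add: positive_op_def)
qed

text \<open>At \<open>r = 1\<close> each new factor \<open>I - P\<close> is a projection commuting
  with the previous product.\<close>

lemma partial_defect_orth_proj:
  assumes "distinct is" "set is \<subseteq> {1..k}"
  shows "orth_proj (partial_defect 1 is)"
  using assms
proof (induction "is")
  case Nil
  then show ?case using orth_proj_id by (simp add: partial_defect_def id_def)
next
  case (Cons i "is")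
  let ?X = "partial_defect 1 is"
  have P: "orth_proj (range_proj i)"
    using Cons.prems by (intro range_proj) auto
  have X: "orth_proj ?X"
    using Cons by simp
  then have X': "adjoint_pair ?X ?X" and XX: "?X (?X x) = ?X x" for x
    by (simp_all add: orth_proj_def)
  have P': "range_proj i (range_proj i x) = range_proj i x"
    "adjoint_pair (range_proj i) (range_proj i)" for x
    using P by (simp_all add: orth_proj_def)
  have "adjoint_pair (partial_defect 1 (i # is)) (partial_defect 1 (i # is))"
    using Cons.prems by (rule partial_defect_props)
  moreover have "partial_defect 1 (i # is) (partial_defect 1 (i # is) x)
      = partial_defect 1 (i # is) x" for x
    using partial_defect_Cons[OF Cons.prems, of 1] P'
    by (simp add: adjoint_pair_diff[OF X'] adjoint_pair_diff[OF P'(2)] XX)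
  ultimately show ?case
    by (simp add: orth_proj_def)
qed

text \<open>The factor of index \<open>j\<close> kills the range of \<open>V j t\<close>, and the
  range projections of the other indices commute with \<open>V j t\<close>.\<close>

lemma partial_defect_V:
  assumes "distinct is" "set is \<subseteq> {1..k}" "j \<in> set is" "t \<in> {1..n j}"
  shows "partial_defect 1 is (V j t x) = 0"
  using assms
proof (induction "is" arbitrary: x)
  case (Cons i "is")
  let ?X = "partial_defect 1 is"
  have X: "adjoint_pair ?X ?X"
    using Cons.prems by (intro partial_defect_props) auto
  show ?case
  proof (cases "j = i")
    case True
    then show ?thesis
      using Cons.prems partial_defect_Cons(1)[of i "is" 1]
      by (simp add: range_proj_V adjoint_pair_zero[OF X])
  next
    case False
    then have "range_proj i (V j t x) = V j t (range_proj i x)"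
      using Cons.prems by (intro range_proj_commute) auto
    then show ?thesis
      using False Cons partial_defect_Cons(1)[of i "is" 1]
      by (simp add: adjoint_pair_diff[OF X])
  qed
qed simp

lemma defect_eq: "defect r k n V = partial_defect r [1..<Suc k]"
  by (simp add: defect_def partial_defect_def)

lemma defect_orth_proj: "orth_proj (defect 1 k n V)"
  unfolding defect_eq by (intro partial_defect_orth_proj) auto

lemma defect_V: "j \<in> {1..k} \<Longrightarrow> t \<in> {1..n j} \<Longrightarrow> defect 1 k n V (V j t x) = 0"
  unfolding defect_eq by (intro partial_defect_V) auto

lemma in_polyball: "V \<in> polyball k n L"
proof -
  have "op_le (\<lambda>x. \<Sum>s = 1..n i. V i s (VS i s x)) id" if i: "i \<in> {1..k}" for i
  proof -
    have "(\<Sum>s = 1..n i. V i s (VS i s x)) = range_proj i x" for x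
      by (simp add: range_proj_def row_map_def)
    then show ?thesis
      using orth_proj_cinner[OF orth_proj_diff[OF range_proj[OF i]]]
      by (simp add: op_le_def positive_op_def del: of_real_power)
  qed
  moreover have "positive_op (defect r k n V)" if "0 \<le> r" "r < 1" for r
    unfolding defect_eq using that by (intro partial_defect_positive) auto
  ultimately show ?thesis
    unfolding polyball_def
    by (intro CollectI conjI ballI allI impI) (blast intro: V_clinear V_V_cross)+
qed

section \<open>Propagation from \<open>H\<close> to \<open>K\<close>\<close>

lemma words_op_invariant:
  assumes V: "\<And>i s x. i \<in> {1..k} \<Longrightarrow> s \<in> {1..n i} \<Longrightarrow> x \<in> M \<Longrightarrow> V i s x \<in> M"
    and \<alpha>: "\<forall>i\<in>{1..k}. set (\<alpha> i) \<subseteq> {1..n i}" and x: "x \<in> M"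
  shows "words_op k V \<alpha> x \<in> M"
proof -
  have word: "word_op (V i) w y \<in> M" if "i \<in> {1..k}" "set w \<subseteq> {1..n i}" "y \<in> M" for i w y
    using that(2) by (induction w) (auto simp: word_op_def intro!: V that)
  have "foldr (\<lambda>i A. word_op (V i) (\<alpha> i) \<circ> A) is id x \<in> M" if "set is \<subseteq> {1..k}" for "is"
    using that \<alpha> x word by (induction "is") auto
  moreover have "set [1..<Suc k] \<subseteq> {1..k}" by auto
  ultimately show ?thesis
    unfolding words_op_def by blast
qed

text \<open>The vectors with null orbit form a subspace containing all words applied to
  \<open>H\<close>; it is closed because the projections are contractions uniformly in
  \<open>m\<close>. A constant sequence \<open>Q\<close> covers the vanishing of a single
  projection.\<close>

lemma orth_proj_tendsto_0:
  fixes Q :: "nat \<Rightarrow> 'k \<Rightarrow> 'k" and J :: "'h \<Rightarrow> 'k"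
  assumes Q: "\<And>m. orth_proj (Q m)"
    and dense: "closure (complex_vs.span
       {words_op k V \<alpha> (J h) | \<alpha> h. \<forall>i\<in>{1..k}. set (\<alpha> i) \<subseteq> {1..n i}}) = UNIV"
    and J: "\<And>h. (\<lambda>m. Q m (J h)) \<longlonglongrightarrow> 0"
    and inv: "\<And>i s x. i \<in> {1..k} \<Longrightarrow> s \<in> {1..n i} \<Longrightarrow> (\<lambda>m. Q m x) \<longlonglongrightarrow> 0 \<Longrightarrow>
       (\<lambda>m. Q m (V i s x)) \<longlonglongrightarrow> 0"
  shows "(\<lambda>m. Q m x) \<longlonglongrightarrow> 0"
proof -
  define M where "M = {x. (\<lambda>m. Q m x) \<longlonglongrightarrow> 0}"
  have Q': "adjoint_pair (Q m) (Q m)" for m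
    using Q by (simp add: orth_proj_def)
  have scaleC: "c *\<^sub>C y \<in> M" if "y \<in> M" for c y
  proof -
    \<comment> \<open>Homogeneity for complex scalars is read off from the inner product.\<close>
    have n: "norm (c *\<^sub>C z) = cmod c * norm z" for z :: 'k
    proof -
      have "complex_of_real ((norm (c *\<^sub>C z))\<^sup>2) = (c * cnj c) * cinner z z"
        by (simp add: cinner_scaleC_left cinner_scaleC_right flip: cinner_self del: of_real_power)
      also have "\<dots> = complex_of_real ((cmod c * norm z)\<^sup>2)"
        by (simp add: cinner_self power_mult_distrib flip: complex_norm_square)
      finally show ?thesis
        by (metis norm_ge_zero mult_nonneg_nonneg of_real_eq_iff power2_eq_imp_eq)
    qed
    have "(\<lambda>m. cmod c * norm (Q m y)) \<longlonglongrightarrow> cmod c * 0"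
      using that by (intro tendsto_intros) (simp add: M_def tendsto_norm_zero)
    then show ?thesis
      by (auto simp: M_def adjoint_pair_scaleC[OF Q'] n intro: tendsto_norm_zero_cancel)
  qed
  have "complex_vs.subspace M"
    using scaleC
    by (auto simp: complex_vs.subspace_def M_def adjoint_pair_zero[OF Q'] adjoint_pair_add[OF Q']
        intro: tendsto_add_zero)
  moreover have "{words_op k V \<alpha> (J h) | \<alpha> h. \<forall>i\<in>{1..k}. set (\<alpha> i) \<subseteq> {1..n i}} \<subseteq> M"
    using words_op_invariant[of M] inv J by (auto simp: M_def)
  ultimately have span: "complex_vs.span
       {words_op k V \<alpha> (J h) | \<alpha> h. \<forall>i\<in>{1..k}. set (\<alpha> i) \<subseteq> {1..n i}} \<subseteq> M"
    by (rule complex_vs.span_minimal[rotated])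
  show ?thesis
  proof (rule LIMSEQ_I)
    fix e :: real assume "e > 0"
    have "x \<in> closure M"
      using closure_mono[OF span] dense by auto
    then obtain y where y: "y \<in> M" "dist y x < e / 2"
      using \<open>e > 0\<close> by (meson closure_approachable half_gt_zero)
    then obtain N where N: "\<And>m. m \<ge> N \<Longrightarrow> norm (Q m y) < e / 2"
      using LIMSEQ_D[of "\<lambda>m. Q m y" 0 "e / 2"] \<open>e > 0\<close> by (auto simp: M_def)
    have "norm (Q m x) < e" if "m \<ge> N" for m
    proof -
      have "norm (Q m x) \<le> norm (Q m y) + norm (Q m (x - y))"
        using norm_triangle_ineq[of "Q m y" "Q m (x - y)"]
        by (simp add: adjoint_pair_diff[OF Q'])
      also have "\<dots> < e"
        using N[OF that] orth_proj_norm_le[OF Q, of m "x - y"] y(2)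
        by (simp add: dist_norm norm_minus_commute)
      finally show ?thesis .
    qed
    then show "\<exists>N. \<forall>m\<ge>N. norm (Q m x - 0) < e" by auto
  qed
qed

lemma funpow_tendsto_0_V:
  assumes i: "i \<in> {1..k}" and j: "j \<in> {1..k}" and t: "t \<in> {1..n j}"
    and x: "(\<lambda>m. (\<Phi> 1 i ^^ m) id x) \<longlonglongrightarrow> 0"
  shows "(\<lambda>m. (\<Phi> 1 i ^^ m) id (V j t x)) \<longlonglongrightarrow> 0"
proof -
  interpret V: bounded_linear "V j t"
    using V_clinear[OF j t] by (simp add: bounded_clinear_def)
  have lim: "(\<lambda>m. V j t ((\<Phi> 1 i ^^ m) id x)) \<longlonglongrightarrow> 0"
    using V.tendsto_zero[OF x] .
  show ?thesis
  proof (cases "i = j")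
    case True
    have "adjoint_pair ((\<Phi> 1 i ^^ m) id) ((\<Phi> 1 i ^^ m) id)" for m
      using funpow_orth_proj[OF i] by (simp add: orth_proj_def)
    then have "(\<Phi> 1 i ^^ Suc m) id (V j t x) = V j t ((\<Phi> 1 i ^^ m) id x)" for m
      using row_map_V i t True by simp
    then show ?thesis
      \<comment> \<open>Passing \<open>V i t\<close> lowers the exponent by one, which the limit
        does not see.\<close>
      using lim by (subst filterlim_sequentially_Suc[symmetric]) simp
  next
    case False
    then show ?thesis
      using lim funpow_commute[OF i j False t] by simp
  qed
qed

end

section \<open>Transfer of purity and of vanishing defect between \<open>T\<close> and
  \<open>V\<close>\<close>

theorem corollary6p3:
  fixes k :: nat
    and n :: "nat \<Rightarrow> nat"
    and L :: phases
    and T :: "'h::complex_hilbert op_tuple"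
    and V :: "'k::complex_hilbert op_tuple"
    and J :: "'h \<Rightarrow> 'k"
  assumes "k \<ge> 1"
    and "\<And>i. i \<in> {1..k} \<Longrightarrow> n i \<ge> 1"
    and "\<And>i j s t. i \<in> {1..k} \<Longrightarrow> j \<in> {1..k} \<Longrightarrow> i \<noteq> j \<Longrightarrow> s \<in> {1..n i} \<Longrightarrow> t \<in> {1..n j} \<Longrightarrow>
           cmod (L i j s t) = 1"
    and "\<And>i j s t. i \<in> {1..k} \<Longrightarrow> j \<in> {1..k} \<Longrightarrow> i \<noteq> j \<Longrightarrow> s \<in> {1..n i} \<Longrightarrow> t \<in> {1..n j} \<Longrightarrow>
           L j i t s = cnj (L i j s t)"
    and "T \<in> polyball k n L"
    and "minimal_dilation k n L T J V"
  shows "(V \<in> polyball k n L \<and> pure_tuple k n V \<longleftrightarrow> T \<in> polyball k n L \<and> pure_tuple k n T)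
    \<and> (defect 1 k n V = (\<lambda>x. 0) \<longleftrightarrow> defect 1 k n T = (\<lambda>x. 0))"
proof -
  have dc: "doubly_commuting_row_isometries k n L V" and J: "isometric_embedding J"
    and inter: "\<And>i s h. i \<in> {1..k} \<Longrightarrow> s \<in> {1..n i} \<Longrightarrow>
        J (cadjoint (T i s) h) = cadjoint (V i s) (J h)"
    and dense: "closure (complex_vs.span
       {words_op k V \<alpha> (J h) | \<alpha> h. \<forall>i\<in>{1..k}. set (\<alpha> i) \<subseteq> {1..n i}}) = UNIV"
    using \<open>minimal_dilation k n L T J V\<close> unfolding minimal_dilation_def by blast+
  interpret doubly_commuting k n L V
    using assms(3,4) dc by (rule doubly_commuting.intro)
  have "bounded_clinear (T i s)" if "i \<in> {1..k}" "s \<in> {1..n i}" for i s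
    using \<open>T \<in> polyball k n L\<close> that by (simp add: polyball_def)
  with J interpret row_dilation k n T V J
    using V_clinear inter by (rule row_dilation.intro)
  \<comment> \<open>Both tuples lie in the polyball, so (i) reduces to the equivalence of
    purity.\<close>
  have "pure_tuple k n V \<longleftrightarrow> pure_tuple k n T"
  proof
    assume V: "pure_tuple k n V"
    have "(\<lambda>m. (row_map 1 (n i) (T i) ^^ m) id h) \<longlonglongrightarrow> 0" if i: "i \<in> {1..k}" for i h
    proof (rule Lim_null_comparison)
      show "\<forall>\<^sub>F m in sequentially. norm ((row_map 1 (n i) (T i) ^^ m) id h)
          \<le> norm ((\<Phi> 1 i ^^ m) id (J h))"
        using compression_norm_le[OF compression_funpow[OF i]] by simp
      show "(\<lambda>m. norm ((\<Phi> 1 i ^^ m) id (J h))) \<longlonglongrightarrow> 0"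
        using V i by (simp add: pure_tuple_def tendsto_norm_zero)
    qed
    then show "pure_tuple k n T"
      by (simp add: pure_tuple_def)
  next
    assume T: "pure_tuple k n T"
    have "(\<lambda>m. (\<Phi> 1 i ^^ m) id x) \<longlonglongrightarrow> 0" if i: "i \<in> {1..k}" for i x
    proof (rule orth_proj_tendsto_0[OF funpow_orth_proj[OF i] dense])
      fix h
      \<comment> \<open>The compression estimate controls the square of the norm, from which the
        norm is recovered afterwards.\<close>
      have "(\<lambda>m. (norm ((\<Phi> 1 i ^^ m) id (J h)))\<^sup>2) \<longlonglongrightarrow> 0"
      proof (rule Lim_null_comparison)
        show "\<forall>\<^sub>F m in sequentially. norm ((norm ((\<Phi> 1 i ^^ m) id (J h)))\<^sup>2)
            \<le> norm ((row_map 1 (n i) (T i) ^^ m) id h) * norm h"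
          using compression_orth_proj_norm_le[OF compression_funpow[OF i] funpow_orth_proj[OF i]]
          by simp
        show "(\<lambda>m. norm ((row_map 1 (n i) (T i) ^^ m) id h) * norm h) \<longlonglongrightarrow> 0"
          using T i by (intro tendsto_mult_left_zero tendsto_norm_zero) (simp add: pure_tuple_def)
      qed
      then show "(\<lambda>m. (\<Phi> 1 i ^^ m) id (J h)) \<longlonglongrightarrow> 0"
        using tendsto_norm_zero_cancel tendsto_null_power by fastforce
    qed (rule funpow_tendsto_0_V[OF i])
    then show "pure_tuple k n V"
      by (simp add: pure_tuple_def)
  qed
  moreover have "defect 1 k n V = (\<lambda>x. 0) \<longleftrightarrow> defect 1 k n T = (\<lambda>x. 0)"
  proof
    assume "defect 1 k n V = (\<lambda>x. 0)"
    then show "defect 1 k n T = (\<lambda>x. 0)"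
      using compression_norm_le[OF compression_defect, of 1] by (simp add: fun_eq_iff)
  next
    assume T: "defect 1 k n T = (\<lambda>x. 0)"
    \<comment> \<open>Read as a constant sequence, whose limit is its value; invariance under
      \<open>V\<close> is immediate because the defect kills all ranges.\<close>
    have "(\<lambda>m::nat. defect 1 k n V x) \<longlonglongrightarrow> 0" for x
    proof (rule orth_proj_tendsto_0[OF defect_orth_proj dense])
      show "(\<lambda>m::nat. defect 1 k n V (J h)) \<longlonglongrightarrow> 0" for h
        using compression_orth_proj_norm_le[OF compression_defect defect_orth_proj, of h] T
        by simp
    qed (simp add: defect_V)
    then show "defect 1 k n V = (\<lambda>x. 0)"
      by (simp add: fun_eq_iff LIMSEQ_const_iff)
  qed
  ultimately show ?thesis
    using in_polyball \<open>T \<in> polyball k n L\<close> by blast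
qed

end
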